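(* Let $f:\mathbb W\to\mathbb R$ be a measurable function with $\mathbb E_\nu\left[|f|(1+e^{-f})\right]<\infty$. Then, $\nu$-a.s., $$-\log\mathbb E_\nu\left[e^{-f}\,\middle|\,\mathcal F_\tau\right]=\inf_{\theta\in\mathcal P_\tau}\mathbb E_\theta\left[f+\log\frac{d\theta}{d\nu}\,\middle|\,\mathcal F_\tau\right],$$ and the infimum is attained uniquely, at the measure $\theta_0$ given by $$d\theta_0=\frac{e^{-f}}{\mathbb E_\nu\left[e^{-f}\,\middle|\,\mathcal F_\tau\right]}\,d\nu .$$
   Context: $n\ge1$; $\mathbb W=C([0,1],\mathbb R^n)$ with its Borel $\sigma$-algebra $\mathcal F$ and a probability measure $\nu$; $(\mathcal F_t)$ is the filtration of the coordinate process $W$, completed with respect to $\nu$; $\tau$ is a stopping time of $(\mathcal F_t)$. $\mathcal P_\tau$ is the set of probability measures $\theta$ on $(\mathbb W,\mathcal F)$ such that $\theta\sim\nu$ (mutual absolute continuity) and $\mathbb E_\nu\left[\frac{d\theta}{d\nu}\,\middle|\,\mathcal F_\tau\right]=1$ $\nu$-a.s. The infimum of a family of random variables is understood as the $\nu$-essential infimum; conditional expectations take values in $(-\infty,+\infty]$. "Attained at $\theta$" means that $\mathbb E_\theta[f+\log\frac{d\theta}{d\nu}|\mathcal F_\tau]$ equals the infimum $\nu$-a.s. *)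

theory Defs
  imports "HOL-Probability.Probability"
begin

text \<open>
  The path space \<open>C([0,1], R^n)\<close> with the Borel sets of the uniform metric. Paths are total
  functions on the reals that are \<open>undefined\<close> outside \<open>[0,1]\<close>, which makes them correspond
  bijectively to the continuous functions on \<open>[0,1]\<close>.
\<close>

definition path_metric :: "(real \<Rightarrow> real ^ 'n) metric"
  where "path_metric = cfunspace (top_of_set {0..1}) euclidean_metric"

definition path_space :: "(real \<Rightarrow> real ^ 'n) measure"
  where "path_space = sigma (mspace path_metric) {U. openin (mtopology_of path_metric) U}"

lemma mspace_path_metric:
  "mspace path_metric = {w \<in> extensional {0..1}. continuous_on {0..1} w}"
proof -
  have "bounded (w ` {0..1})" if "continuous_on {0..1::real} w" for w :: "real \<Rightarrow> real ^ 'n"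
    using that by (intro compact_imp_bounded compact_continuous_image) auto
  then show ?thesis
    by (auto simp: path_metric_def mtopology_of_def)
qed

lemma space_path_space: "space path_space = {w \<in> extensional {0..1}. continuous_on {0..1} w}"
proof -
  have "{U. openin (mtopology_of path_metric) U} \<subseteq> Pow (mspace path_metric)"
    using openin_subset by fastforce
  then show ?thesis
    unfolding path_space_def mspace_path_metric[symmetric] by (rule space_measure_of)
qed

lemma borel_measurable_coordinate:
  assumes s: "s \<in> {0..1}"
  shows "(\<lambda>w. w s) \<in> borel_measurable (path_space :: (real \<Rightarrow> real ^ 'n) measure)"
proof (rule borel_measurableI)
  fix S :: "(real ^ 'n) set" assume S: "open S"
  interpret P: Metric_space "mspace path_metric" "mdist (path_metric :: (real \<Rightarrow> real ^ 'n) metric)"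
    by (rule Metric_space_mspace_mdist)
  let ?U = "{w \<in> mspace path_metric. w s \<in> S}"
  have "\<exists>r>0. P.mball w r \<subseteq> ?U" if w: "w \<in> ?U" for w
  proof -
    have "w s \<in> S"
      using w by simp
    then obtain r where r: "r > 0" "ball (w s) r \<subseteq> S"
      using openE[OF S] by metis
    have "v \<in> ?U" if v: "v \<in> P.mball w r" for v
    proof -
      have "v \<in> mspace path_metric" "mdist path_metric w v < r"
        using v by simp_all
      moreover have "w \<in> mspace path_metric"
        using w by simp
      moreover have "compactin (top_of_set {0..1::real}) (topspace (top_of_set {0..1}))"
        by (simp add: compactin_subtopology)
      moreover have "s \<in> topspace (top_of_set {0..1})"
        using s by simp
      ultimately have "mdist euclidean_metric (w s) (v s) < r"
        unfolding path_metric_def by (blast intro: cfunspace_mdist_lt)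
      then have "v s \<in> ball (w s) r"
        by simp
      then have "v s \<in> S"
        using r by blast
      with \<open>v \<in> mspace path_metric\<close> show ?thesis by simp
    qed
    then show ?thesis
      using r by blast
  qed
  then have "openin P.mtopology ?U"
    unfolding P.openin_mtopology by blast
  then have "?U \<in> {U. openin (mtopology_of path_metric) U}"
    by (simp add: mtopology_of_def)
  moreover have "{U. openin (mtopology_of path_metric) U} \<subseteq> Pow (mspace (path_metric :: (real \<Rightarrow> real ^ 'n) metric))"
    using openin_subset by fastforce
  ultimately have "?U \<in> sets path_space"
    unfolding path_space_def by (subst sets_measure_of) (auto intro: sigma_sets.Basic)
  also have "?U = (\<lambda>w. w s) -` S \<inter> space path_space"
    unfolding space_path_space mspace_path_metric by blast
  finally show "(\<lambda>w. w s) -` S \<inter> space path_space \<in> sets path_space" .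
qed

text \<open>
  The filtration of the coordinate process, completed with respect to \<open>\<nu>\<close>: the \<open>\<nu>\<close>-null sets are
  those of the completion of \<open>\<nu>\<close>, so each \<open>\<F>\<^sub>t\<close> is a sub-\<open>\<sigma>\<close>-algebra of \<^term>\<open>completion \<nu>\<close> but not
  necessarily of \<open>\<nu>\<close>. The index type is \<^typ>\<open>ereal\<close> so that stopping times may take the value
  \<open>\<infinity>\<close>; one has \<open>\<F>\<^sub>t = \<F>\<^sub>1\<close> for \<open>t \<ge> 1\<close>, and \<open>\<F>\<^sub>t\<close> is the \<open>\<nu>\<close>-trivial \<open>\<sigma>\<close>-algebra for \<open>t < 0\<close>.
\<close>

definition path_filtration ::
    "(real \<Rightarrow> real ^ 'n) measure \<Rightarrow> ereal \<Rightarrow> (real \<Rightarrow> real ^ 'n) measure"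
  where "path_filtration \<nu> t = sigma (space \<nu>)
    ({{w \<in> space \<nu>. w s \<in> B} |s B. s \<in> {0..1} \<and> ereal s \<le> t \<and> B \<in> sets borel}
      \<union> null_sets (completion \<nu>))"

lemma null_sets_completion_into_space: "null_sets (completion \<nu>) \<subseteq> Pow (space \<nu>)"
  using sets.sets_into_space by fastforce

lemma space_path_filtration [simp]: "space (path_filtration \<nu> t) = space \<nu>"
  unfolding path_filtration_def using null_sets_completion_into_space[of \<nu>]
  by (intro space_measure_of) auto

lemma filtration_path_filtration: "filtration (space \<nu>) (path_filtration \<nu>)"
proof
  show "space (path_filtration \<nu> t) = space \<nu>" for t by simp
  show "sets (path_filtration \<nu> s) \<le> sets (path_filtration \<nu> t)" if "s \<le> t" for s t
    unfolding path_filtration_def using that null_sets_completion_into_space[of \<nu>]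
    by (subst (1 2) sets_measure_of) (auto intro!: sigma_sets_mono' intro: order_trans)
qed

definition path_stopping_time ::
    "(real \<Rightarrow> real ^ 'n) measure \<Rightarrow> ((real \<Rightarrow> real ^ 'n) \<Rightarrow> ereal) \<Rightarrow> bool"
  where "path_stopping_time \<nu> \<tau> \<longleftrightarrow>
    (\<forall>w\<in>space \<nu>. \<tau> w \<in> {0..1} \<union> {\<infinity>}) \<and> stopping_time (path_filtration \<nu>) \<tau>"

definition stopped_algebra ::
    "(real \<Rightarrow> real ^ 'n) measure \<Rightarrow> ((real \<Rightarrow> real ^ 'n) \<Rightarrow> ereal) \<Rightarrow> (real \<Rightarrow> real ^ 'n) measure"
  where "stopped_algebra \<nu> \<tau> = filtration.pre_sigma (space \<nu>) (path_filtration \<nu>) \<tau>"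

lemma subalgebra_stopped_algebra:
  assumes \<nu>: "sets \<nu> = sets path_space" and \<tau>: "path_stopping_time \<nu> \<tau>"
  shows "subalgebra (completion \<nu>) (stopped_algebra \<nu> \<tau>)"
proof -
  interpret filtration "space \<nu>" "path_filtration \<nu>"
    by (rule filtration_path_filtration)
  have "{w \<in> space \<nu>. w s \<in> B} \<in> sets (completion \<nu>)"
    if "s \<in> {0..1}" "B \<in> sets borel" for s and B :: "(real ^ 'a) set"
  proof -
    have "(\<lambda>w. w s) \<in> borel_measurable \<nu>"
      using borel_measurable_coordinate[OF that(1)] measurable_cong_sets[OF \<nu> refl] by blast
    then show ?thesis
      using measurable_sets[OF _ that(2)]
      by (auto intro!: sets_completionI_sets simp: vimage_def Int_def conj_commute)
  qed
  then have "{{w \<in> space \<nu>. w s \<in> B} |s B. s \<in> {0..1} \<and> ereal s \<le> \<infinity> \<and> B \<in> sets borel}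
      \<union> null_sets (completion \<nu>) \<subseteq> sets (completion \<nu>)"
    by blast
  from sets.sigma_sets_subset[OF this]
  have *: "sets (path_filtration \<nu> \<infinity>) \<subseteq> sets (completion \<nu>)"
    unfolding path_filtration_def using null_sets_completion_into_space[of \<nu>]
    by (subst sets_measure_of) auto
  have "A \<in> sets (completion \<nu>)" if "A \<in> sets (stopped_algebra \<nu> \<tau>)" for A
    using sets_pre_sigmaD[of \<tau> A \<infinity>] \<tau> that *
    by (auto simp: stopped_algebra_def path_stopping_time_def)
  then show ?thesis
    by (auto simp: subalgebra_def stopped_algebra_def space_pre_sigma)
qed

text \<open>
  Conditional expectation with values in \<open>(-\<infinity>, \<infinity>]\<close>; meaningful (almost everywhere) when the
  negative part of \<open>g\<close> is integrable. It is the difference of the conditional expectations of the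
  positive and the negative part, as in \<^const>\<open>real_cond_exp\<close>, but \<open>\<infinity>\<close> is not truncated to \<open>0\<close>.
\<close>

definition ereal_cond_exp ::
    "'a measure \<Rightarrow> 'a measure \<Rightarrow> ('a \<Rightarrow> real) \<Rightarrow> 'a \<Rightarrow> ereal"
  where "ereal_cond_exp M F g x =
    enn2ereal (nn_cond_exp M F (\<lambda>x. ennreal (g x)) x)
      - enn2ereal (nn_cond_exp M F (\<lambda>x. ennreal (- g x)) x)"

definition is_ess_inf :: "'a measure \<Rightarrow> 'i set \<Rightarrow> ('i \<Rightarrow> 'a \<Rightarrow> ereal) \<Rightarrow> ('a \<Rightarrow> ereal) \<Rightarrow> bool"
  where "is_ess_inf M I X Z \<longleftrightarrow>
    Z \<in> borel_measurable M \<and>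
    (\<forall>i\<in>I. AE x in M. Z x \<le> X i x) \<and>
    (\<forall>Y\<in>borel_measurable M. (\<forall>i\<in>I. AE x in M. Y x \<le> X i x) \<longrightarrow> (AE x in M. Y x \<le> Z x))"

text \<open>
  Since \<open>\<F>\<^sub>\<tau>\<close> contains \<open>\<nu>\<close>-null sets outside the Borel sets, conditional expectations are taken
  under the completed measures. If \<open>\<theta> \<sim> \<nu>\<close>, the completions of \<open>\<theta>\<close> and \<open>\<nu>\<close> have the same sets,
  so \<open>\<F>\<^sub>\<tau>\<close> is a sub-\<open>\<sigma>\<close>-algebra of both.
\<close>

definition admissible_measures ::
    "(real \<Rightarrow> real ^ 'n) measure \<Rightarrow> ((real \<Rightarrow> real ^ 'n) \<Rightarrow> ereal) \<Rightarrow> (real \<Rightarrow> real ^ 'n) measure set"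
  where "admissible_measures \<nu> \<tau> = {\<theta>. prob_space \<theta> \<and> sets \<theta> = sets path_space \<and>
    absolutely_continuous \<nu> \<theta> \<and> absolutely_continuous \<theta> \<nu> \<and>
    (AE w in \<nu>. nn_cond_exp (completion \<nu>) (stopped_algebra \<nu> \<tau>) (RN_deriv \<nu> \<theta>) w = 1)}"

definition cond_free_energy ::
    "(real \<Rightarrow> real ^ 'n) measure \<Rightarrow> ((real \<Rightarrow> real ^ 'n) \<Rightarrow> ereal) \<Rightarrow> ((real \<Rightarrow> real ^ 'n) \<Rightarrow> real) \<Rightarrow>
      (real \<Rightarrow> real ^ 'n) measure \<Rightarrow> (real \<Rightarrow> real ^ 'n) \<Rightarrow> ereal"
  where "cond_free_energy \<nu> \<tau> f \<theta> = ereal_cond_exp (completion \<theta>) (stopped_algebra \<nu> \<tau>)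
    (\<lambda>w. f w + ln (enn2real (RN_deriv \<nu> \<theta> w)))"

definition cond_partition ::
    "(real \<Rightarrow> real ^ 'n) measure \<Rightarrow> ((real \<Rightarrow> real ^ 'n) \<Rightarrow> ereal) \<Rightarrow> ((real \<Rightarrow> real ^ 'n) \<Rightarrow> real) \<Rightarrow>
      (real \<Rightarrow> real ^ 'n) \<Rightarrow> real"
  where "cond_partition \<nu> \<tau> f = real_cond_exp (completion \<nu>) (stopped_algebra \<nu> \<tau>) (\<lambda>w. exp (- f w))"

text \<open>
  The density is measurable only for the completed \<open>\<sigma>\<close>-algebra, so the measure it defines there is
  restricted to the Borel sets of the path space.
\<close>

definition gibbs_measure ::
    "(real \<Rightarrow> real ^ 'n) measure \<Rightarrow> ((real \<Rightarrow> real ^ 'n) \<Rightarrow> ereal) \<Rightarrow> ((real \<Rightarrow> real ^ 'n) \<Rightarrow> real) \<Rightarrow>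
      (real \<Rightarrow> real ^ 'n) measure"
  where "gibbs_measure \<nu> \<tau> f = restr_to_subalg
    (density (completion \<nu>) (\<lambda>w. ennreal (exp (- f w) / cond_partition \<nu> \<tau> f w))) path_space"

end

theory Submission
  imports Defs
begin

text \<open>
  Write \<open>D\<close> for the density of \<open>\<theta>\<close>, \<open>Z\<close> for the conditional partition function and
  \<open>D\<^sub>0 = exp (- f) / Z\<close>. The conditional free energy of \<open>\<theta>\<close> exceeds \<open>- ln Z\<close> by exactly the
  conditional relative entropy of \<open>\<theta>\<close> with respect to the Gibbs measure, which is the conditional
  expectation of \<open>D * (x - 1 - ln x) \<ge> 0\<close> with \<open>x = D\<^sub>0 / D\<close>. It vanishes iff \<open>D = D\<^sub>0\<close>. Splitting all
  terms into positive and negative parts gives this identity in \<open>[0, \<infinity>]\<close>, without integrability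
  of \<open>ln Z\<close> or of the energy.
\<close>

section \<open>Densities and completed measures\<close>

lemma null_sets_density_pos:
  assumes "D \<in> borel_measurable M" "AE x in M. D x \<noteq> (0 :: ennreal)"
  shows "null_sets (density M D) = null_sets M"
proof (intro set_eqI)
  fix A show "A \<in> null_sets (density M D) \<longleftrightarrow> A \<in> null_sets M"
  proof
    assume "A \<in> null_sets (density M D)"
    then have A: "A \<in> sets M" "AE x in M. x \<in> A \<longrightarrow> D x = 0"
      by (simp_all add: null_sets_density_iff assms)
    have "AE x in M. x \<notin> A"
      using A(2) assms(2) by eventually_elim auto
    then show "A \<in> null_sets M"
      using A(1) by (simp add: AE_iff_null_sets)
  next
    assume "A \<in> null_sets M"
    then show "A \<in> null_sets (density M D)"
      using absolutely_continuousI_density[OF assms(1)] by (auto simp: absolutely_continuous_def)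
  qed
qed

text \<open>A function measurable only for the completion agrees almost everywhere with one
  measurable for \<open>M\<close>, and null sets of \<open>M\<close> stay null under the
  density.\<close>

lemma nn_integral_completion_density:
  assumes [measurable]: "D \<in> borel_measurable M" and u: "u \<in> borel_measurable (completion M)"
  shows "(\<integral>\<^sup>+x. u x \<partial>density M D) = (\<integral>\<^sup>+x. D x * u x \<partial>M)"
proof -
  obtain u' where [measurable]: "u' \<in> borel_measurable M" and eq: "AE x in M. u x = u' x"
    using completion_ex_borel_measurable[OF u] by blast
  have "AE x in density M D. u x = u' x"
    using eq by (auto simp: AE_density elim: eventually_mono)
  then have "(\<integral>\<^sup>+x. u x \<partial>density M D) = (\<integral>\<^sup>+x. u' x \<partial>density M D)"
    by (rule nn_integral_cong_AE)
  also have "\<dots> = (\<integral>\<^sup>+x. D x * u' x \<partial>M)"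
    by (simp add: nn_integral_density)
  also have "\<dots> = (\<integral>\<^sup>+x. D x * u x \<partial>M)"
    using eq by (intro nn_integral_cong_AE) auto
  finally show ?thesis .
qed

text \<open>A density that is almost everywhere nonzero leaves the null sets unchanged, so both
  sides carry the same sigma-algebra. This places the completion of every admissible \<theta> over
  the completion of \<nu>, where all conditional expectations can be compared.\<close>

lemma completion_density:
  assumes D: "D \<in> borel_measurable M" and pos: "AE x in M. D x \<noteq> (0 :: ennreal)"
  shows "completion (density M D) = density (completion M) D"
proof (rule measure_eqI)
  show eq: "sets (completion (density M D)) = sets (density (completion M) D)"
    by (simp add: sets_completion null_sets_density_pos[OF D pos])
  fix A assume A: "A \<in> sets (completion (density M D))"
  then have A': "A \<in> sets (completion M)"
    using eq by simp
  have "emeasure (completion (density M D)) A = (\<integral>\<^sup>+x. indicator A x \<partial>completion (density M D))"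
    using A by simp
  also have "\<dots> = (\<integral>\<^sup>+x. D x * indicator A x \<partial>M)"
    using A' by (subst nn_integral_completion, intro nn_integral_completion_density[OF D]) simp
  also have "\<dots> = emeasure (density (completion M) D) A"
    using A' D by (simp add: emeasure_density measurable_completion nn_integral_completion)
  finally show "emeasure (completion (density M D)) A = emeasure (density (completion M) D) A" .
qed

section \<open>Signed identities in [0, infinity]\<close>

text \<open>Since \<open>ennreal\<close> truncates at 0, \<open>ennreal a\<close> and
  \<open>ennreal (- a)\<close> are the positive and negative parts of \<open>a\<close>. Moving the
  negative parts across leaves only nonnegative summands.\<close>

lemma ennreal_signed_balance:
  assumes "a + p + c = r + q" "0 \<le> p" "0 \<le> q" "0 \<le> r"
  shows "ennreal a + ennreal p + ennreal c = ennreal r + ennreal q + ennreal (- a) + ennreal (- c)"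
  using assms
  by (cases "0 \<le> a"; cases "0 \<le> c")
     (simp_all add: ennreal_neg ennreal_plus[symmetric] del: ennreal_plus)

text \<open>The ones stand for the conditional expectations of the two densities and cancel. If
  \<open>a\<close> is infinite then so is \<open>r\<close>, because \<open>b\<close> and
  \<open>z\<close> are finite; otherwise all terms are finite and real arithmetic applies.
  Finiteness of \<open>b\<close> excludes infinity minus infinity.\<close>

lemma ereal_diff_of_ennreal_balance:
  assumes eq: "a + 1 + ennreal z = r + 1 + b + ennreal (- z)" and b: "b < \<infinity>"
  shows "enn2ereal a - enn2ereal b = enn2ereal r - ereal z"
proof -
  obtain b' where b': "b = ennreal b'" "0 \<le> b'"
    using b by (cases b) auto
  show ?thesis
  proof (cases "a = \<infinity>")
    case True
    then have "r + 1 + b + ennreal (- z) = \<infinity>"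
      using eq by simp
    then have "r = \<infinity>"
      using b by auto
    with True b' show ?thesis by simp
  next
    case False
    then have "r \<noteq> \<infinity>"
      using eq by (metis ennreal_add_eq_top ennreal_neq_top ennreal_one_neq_top infinity_ennreal_def)
    then obtain r' where r': "r = ennreal r'" "0 \<le> r'"
      by (cases r) auto
    obtain a' where a': "a = ennreal a'" "0 \<le> a'"
      using False by (cases a) auto
    have "ennreal (a' + 1 + max 0 z) = ennreal (r' + 1 + b' + max 0 (- z))"
      using eq a' b' r' by simp
    then have "a' + 1 + max 0 z = r' + 1 + b' + max 0 (- z)"
      using a' b' r' by (subst (asm) ennreal_inj) auto
    then have "a' - b' = r' - z"
      by (auto simp: max_def split: if_splits)
    then show ?thesis
      using a' b' r' by simp
  qed
qed

section \<open>Conditional expectation under a change of measure\<close>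

context finite_measure_subalgebra
begin

lemma nn_integral_nn_cond_exp:
  assumes "u \<in> borel_measurable M"
  shows "(\<integral>\<^sup>+x. nn_cond_exp M F u x \<partial>M) = (\<integral>\<^sup>+x. u x \<partial>M)"
  using nn_cond_exp_intg[of "\<lambda>_. 1" u] assms by simp

lemma emeasure_density_cond_exp_1:
  assumes D: "D \<in> borel_measurable M" and one: "AE x in M. nn_cond_exp M F D x = 1"
  shows "emeasure (density M D) (space M) = emeasure M (space M)"
proof -
  have "emeasure (density M D) (space M) = (\<integral>\<^sup>+x. D x \<partial>M)"
    using D by (auto simp: emeasure_density intro!: nn_integral_cong)
  also have "\<dots> = (\<integral>\<^sup>+x. 1 \<partial>M)"
    unfolding nn_integral_nn_cond_exp[OF D, symmetric] using one by (rule nn_integral_cong_AE)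
  finally show ?thesis by simp
qed

text \<open>This is the abstract Bayes formula, whose denominator, the conditional expectation of
  \<open>D\<close>, equals 1.\<close>

lemma nn_cond_exp_density:
  assumes D[measurable]: "D \<in> borel_measurable M" and u[measurable]: "u \<in> borel_measurable M"
    and one: "AE x in M. nn_cond_exp M F D x = 1"
  shows "AE x in density M D. nn_cond_exp M F (\<lambda>x. D x * u x) x = nn_cond_exp (density M D) F u x"
proof -
  interpret N: finite_measure "density M D"
    using emeasure_density_cond_exp_1[OF D one] by (intro finite_measureI) simp
  interpret N: finite_measure_subalgebra "density M D" F
    using subalg by unfold_locales (simp add: subalgebra_def)
  let ?E = "nn_cond_exp M F (\<lambda>x. D x * u x)"
  show ?thesis
  proof (rule N.nn_cond_exp_charact)
    fix A assume A[measurable]: "A \<in> sets F"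
    have A'[measurable]: "A \<in> sets M"
      using A subalg by (auto simp: subalgebra_def)
    have "(\<integral>\<^sup>+x\<in>A. u x \<partial>density M D) = (\<integral>\<^sup>+x. indicator A x * (D x * u x) \<partial>M)"
      by (simp add: nn_integral_density ac_simps)
    also have "\<dots> = (\<integral>\<^sup>+x. indicator A x * ?E x \<partial>M)"
      by (rule nn_cond_exp_intg[symmetric]) auto
    \<comment> \<open>The factor 1 enters as the conditional expectation of \<open>D\<close>. The
      rest of the integrand is measurable for \<open>F\<close>, so this factor may then be replaced
      by \<open>D\<close> itself.\<close>
    also have "\<dots> = (\<integral>\<^sup>+x. (indicator A x * ?E x) * nn_cond_exp M F D x \<partial>M)"
      using one by (intro nn_integral_cong_AE) auto
    also have "\<dots> = (\<integral>\<^sup>+x. (indicator A x * ?E x) * D x \<partial>M)"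
      by (rule nn_cond_exp_intg) auto
    also have "\<dots> = (\<integral>\<^sup>+x\<in>A. ?E x \<partial>density M D)"
      by (simp add: nn_integral_density ac_simps)
    finally show "(\<integral>\<^sup>+x\<in>A. u x \<partial>density M D) = (\<integral>\<^sup>+x\<in>A. ?E x \<partial>density M D)" .
  qed auto
qed

text \<open>\<open>real_cond_exp\<close> would turn the value infinity into 0. Integrability makes
  that value a null event, and the negative part contributes nothing.\<close>

lemma nn_cond_exp_eq_real_cond_exp:
  assumes g: "integrable M g" and nonneg: "\<And>x. 0 \<le> g x"
  shows "AE x in M. nn_cond_exp M F (\<lambda>x. ennreal (g x)) x = ennreal (real_cond_exp M F g x)"
proof -
  have [measurable]: "g \<in> borel_measurable M"
    using g by simp
  have "(\<integral>\<^sup>+x. nn_cond_exp M F (\<lambda>x. ennreal (g x)) x \<partial>M) \<noteq> \<infinity>"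
    using g nonneg by (simp add: nn_integral_nn_cond_exp nn_integral_eq_integral)
  then have "AE x in M. nn_cond_exp M F (\<lambda>x. ennreal (g x)) x \<noteq> \<infinity>"
    by (intro nn_integral_PInf_AE) auto
  moreover have "AE x in M. 0 = nn_cond_exp M F (\<lambda>x. ennreal (- g x)) x"
    using nn_cond_exp_F_meas[of "\<lambda>_. 0"] nonneg by (simp add: ennreal_neg)
  ultimately show ?thesis
    by eventually_elim (simp add: real_cond_exp_def less_top)
qed

text \<open>Both sides say that an integral vanishes, and conditioning preserves the
  integral.\<close>

lemma nn_cond_exp_eq_0_iff:
  assumes [measurable]: "u \<in> borel_measurable M"
  shows "(AE x in M. nn_cond_exp M F u x = 0) \<longleftrightarrow> (AE x in M. u x = 0)"
  using nn_integral_nn_cond_exp[OF assms] nn_integral_0_iff_AE[of u M]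
    nn_integral_0_iff_AE[of "nn_cond_exp M F u" M] by simp

section \<open>The Gibbs density and relative entropy\<close>

definition gibbs_density :: "('a \<Rightarrow> real) \<Rightarrow> 'a \<Rightarrow> real"
  where "gibbs_density f x = exp (- f x) / real_cond_exp M F (\<lambda>x. exp (- f x)) x"

text \<open>With \<open>g = gibbs_density f x\<close> and positive values this is
  \<open>d x * ln (d x / g) + g - d x\<close>. The correction \<open>g - d x\<close> averages out,
  since both densities have conditional expectation 1, and it makes the integrand nonnegative
  pointwise.\<close>

definition relative_entropy_density :: "('a \<Rightarrow> real) \<Rightarrow> ('a \<Rightarrow> real) \<Rightarrow> 'a \<Rightarrow> real"
  where "relative_entropy_density f d x =
    d x * (gibbs_density f x / d x - 1 - ln (gibbs_density f x / d x))"

context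
  fixes f :: "'a \<Rightarrow> real"
  assumes f[measurable]: "f \<in> borel_measurable M"
    and int: "integrable M (\<lambda>x. exp (- f x))"
begin

abbreviation "partition_fun \<equiv> real_cond_exp M F (\<lambda>x. exp (- f x))"

lemma gibbs_density_measurable [measurable]: "gibbs_density f \<in> borel_measurable M"
  unfolding gibbs_density_def by measurable

lemma partition_fun_pos: "AE x in M. 0 < partition_fun x"
  using int by (intro real_cond_exp_gr_c) auto

lemma gibbs_density_pos: "AE x in M. 0 < gibbs_density f x"
  using partition_fun_pos by eventually_elim (simp add: gibbs_density_def)

text \<open>The factor \<open>1 / partition_fun x\<close> is measurable for \<open>F\<close>, so it
  leaves the conditional expectation and cancels against \<open>partition_fun x\<close>.\<close>

lemma nn_cond_exp_gibbs_density:
  "AE x in M. nn_cond_exp M F (\<lambda>x. ennreal (gibbs_density f x)) x = 1"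
proof -
  let ?g = "\<lambda>x. ennreal (exp (- f x))"
  have "AE x in M. ennreal (1 / partition_fun x) * nn_cond_exp M F ?g x =
      nn_cond_exp M F (\<lambda>x. ennreal (1 / partition_fun x) * ?g x) x"
    by (rule nn_cond_exp_prod) auto
  moreover have "AE x in M. nn_cond_exp M F (\<lambda>x. ennreal (1 / partition_fun x) * ?g x) x =
      nn_cond_exp M F (\<lambda>x. ennreal (gibbs_density f x)) x"
  proof (rule nn_cond_exp_cong)
    show "AE x in M. ennreal (1 / partition_fun x) * ?g x = ennreal (gibbs_density f x)"
      using partition_fun_pos
      by eventually_elim (simp add: gibbs_density_def ennreal_mult[symmetric])
  qed auto
  ultimately show ?thesis
    using nn_cond_exp_eq_real_cond_exp[OF int exp_ge_zero] partition_fun_pos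
  proof eventually_elim
    case (elim x)
    have "ennreal (1 / partition_fun x) * ennreal (partition_fun x) = 1"
      using elim(4) by (subst ennreal_mult[symmetric]) auto
    with elim(1-3) show ?case by simp
  qed
qed

section \<open>The energy of a competing density\<close>

context
  fixes d :: "'a \<Rightarrow> real"
  assumes d[measurable]: "d \<in> borel_measurable M"
    and d_pos: "AE x in M. 0 < d x"
    and d_one: "AE x in M. nn_cond_exp M F (\<lambda>x. ennreal (d x)) x = 1"
begin

lemma relative_entropy_density_measurable [measurable]:
  "relative_entropy_density f d \<in> borel_measurable M"
  unfolding relative_entropy_density_def by measurable

lemma relative_entropy_density_nonneg: "AE x in M. 0 \<le> relative_entropy_density f d x"
  using d_pos gibbs_density_pos
proof eventually_elim
  case (elim x)
  then have "ln (gibbs_density f x / d x) \<le> gibbs_density f x / d x - 1"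
    by (intro ln_le_minus_one) simp
  then show ?case
    using elim unfolding relative_entropy_density_def by (intro mult_nonneg_nonneg) simp_all
qed

text \<open>Equality in \<open>ln y \<le> y - 1\<close> forces \<open>y = 1\<close>. Uniqueness of
  the minimiser rests on this.\<close>

lemma relative_entropy_density_eq_0_iff:
  "AE x in M. relative_entropy_density f d x = 0 \<longleftrightarrow> d x = gibbs_density f x"
  using d_pos gibbs_density_pos
proof eventually_elim
  case (elim x)
  then have "gibbs_density f x / d x = 1" if "relative_entropy_density f d x = 0"
    using that unfolding relative_entropy_density_def by (intro ln_eq_minus_one) auto
  then show ?case
    using elim by (auto simp: relative_entropy_density_def)
qed

text \<open>The logarithm of \<open>gibbs_density f x / d x\<close> is expanded. The two densities
  stay on opposite sides, so that only the energy and the logarithm of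
  \<open>partition_fun x\<close> have unknown sign.\<close>

lemma energy_balance:
  assumes "0 < d x" "0 < partition_fun x"
  shows "d x * (f x + ln (d x)) + gibbs_density f x + d x * ln (partition_fun x)
    = relative_entropy_density f d x + d x"
proof -
  have "ln (gibbs_density f x / d x) = - f x - ln (partition_fun x) - ln (d x)"
    using assms by (simp add: gibbs_density_def ln_div ln_mult)
  then show ?thesis
    using assms by (simp only: relative_entropy_density_def) (simp add: algebra_simps)
qed

text \<open>Since \<open>- L \<le> exp (- L)\<close>, the negative part of the energy is controlled by \<open>exp (- f)\<close>.\<close>

lemma energy_negative_part_le:
  assumes "0 < d x"
  shows "d x * - (f x + ln (d x)) \<le> exp (- f x)"
proof -
  have "- (f x + ln (d x)) \<le> exp (- (f x + ln (d x)))"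
    using exp_ge_add_one_self[of "- (f x + ln (d x))"] by linarith
  then have "d x * - (f x + ln (d x)) \<le> d x * exp (- (f x + ln (d x)))"
    using assms by (intro mult_left_mono) auto
  also have "\<dots> = exp (- f x)"
    using assms by (simp add: exp_diff exp_minus field_simps)
  finally show ?thesis .
qed

text \<open>The pointwise balance is split into parts and conditioned term by term. The logarithm of
  \<open>partition_fun\<close> is measurable for \<open>F\<close> and comes out; the conditional
  expectations of the two densities become the ones.\<close>

lemma cond_energy_balance:
  "AE x in M. nn_cond_exp M F (\<lambda>x. ennreal (d x) * ennreal (f x + ln (d x))) x + 1
      + ennreal (ln (partition_fun x))
    = nn_cond_exp M F (\<lambda>x. ennreal (relative_entropy_density f d x)) x + 1
      + nn_cond_exp M F (\<lambda>x. ennreal (d x) * ennreal (- (f x + ln (d x)))) x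
      + ennreal (- ln (partition_fun x))"
proof -
  let ?E = "nn_cond_exp M F"
  let ?a = "\<lambda>x. ennreal (d x) * ennreal (f x + ln (d x))"
  let ?b = "\<lambda>x. ennreal (d x) * ennreal (- (f x + ln (d x)))"
  let ?c = "\<lambda>x. ennreal (ln (partition_fun x)) * ennreal (d x)"
  let ?c' = "\<lambda>x. ennreal (- ln (partition_fun x)) * ennreal (d x)"
  let ?r = "\<lambda>x. ennreal (relative_entropy_density f d x)"
  let ?p = "\<lambda>x. ennreal (gibbs_density f x)"
  let ?q = "\<lambda>x. ennreal (d x)"
  have "AE x in M. ?E (\<lambda>x. ?a x + ?p x + ?c x) x = ?E (\<lambda>x. ?r x + ?q x + ?b x + ?c' x) x"
  proof (rule nn_cond_exp_cong)
    show "AE x in M. ?a x + ?p x + ?c x = ?r x + ?q x + ?b x + ?c' x"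
      using d_pos partition_fun_pos gibbs_density_pos relative_entropy_density_nonneg
    proof eventually_elim
      case (elim x)
      \<comment> \<open>Because \<open>d x\<close> is positive, truncation at 0 commutes with the
        product for \<open>y\<close> of either sign.\<close>
      have e: "ennreal (d x * y) = ennreal (d x) * ennreal y" for y
        using elim by (simp only: ennreal_mult' less_imp_le)
      from ennreal_signed_balance[OF energy_balance[OF elim(1,2)] less_imp_le[OF elim(3)]
          less_imp_le[OF elim(1)] elim(4)]
      show ?case
        unfolding mult.commute[of _ "ennreal (d x)"] e[symmetric] mult_minus_right .
    qed
  qed auto
  moreover have "AE x in M. ?E (\<lambda>x. ?a x + ?p x) x + ?E ?c x = ?E (\<lambda>x. ?a x + ?p x + ?c x) x"
    and "AE x in M. ?E ?a x + ?E ?p x = ?E (\<lambda>x. ?a x + ?p x) x"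
    and "AE x in M. ?E (\<lambda>x. ?r x + ?q x + ?b x) x + ?E ?c' x
      = ?E (\<lambda>x. ?r x + ?q x + ?b x + ?c' x) x"
    and "AE x in M. ?E (\<lambda>x. ?r x + ?q x) x + ?E ?b x = ?E (\<lambda>x. ?r x + ?q x + ?b x) x"
    and "AE x in M. ?E ?r x + ?E ?q x = ?E (\<lambda>x. ?r x + ?q x) x"
    by (rule nn_cond_exp_sum; measurable)+
  moreover have "AE x in M. ennreal (ln (partition_fun x)) * ?E ?q x = ?E ?c x"
    and "AE x in M. ennreal (- ln (partition_fun x)) * ?E ?q x = ?E ?c' x"
    by (rule nn_cond_exp_prod; measurable)+
  ultimately show ?thesis
    using nn_cond_exp_gibbs_density d_one by eventually_elim simp
qed

lemma ereal_cond_exp_energy: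
  "AE x in M. ereal_cond_exp (density M (\<lambda>x. ennreal (d x))) F (\<lambda>x. f x + ln (d x)) x
    = enn2ereal (nn_cond_exp M F (\<lambda>x. ennreal (relative_entropy_density f d x)) x)
      - ereal (ln (partition_fun x))"
proof -
  let ?N = "density M (\<lambda>x. ennreal (d x))"
  let ?b = "\<lambda>x. ennreal (d x) * ennreal (- (f x + ln (d x)))"
  have bayes: "AE x in M. nn_cond_exp M F (\<lambda>x. ennreal (d x) * u x) x = nn_cond_exp ?N F u x"
    if "u \<in> borel_measurable M" for u
  proof -
    \<comment> \<open>The Bayes formula holds almost everywhere for the density measure, hence only
      where \<open>d\<close> is positive; that is almost everywhere in \<open>M\<close>.\<close>
    have "AE x in M. 0 < d x \<longrightarrow>
        nn_cond_exp M F (\<lambda>x. ennreal (d x) * u x) x = nn_cond_exp ?N F u x"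
      using nn_cond_exp_density[OF _ that d_one] by (simp add: AE_density)
    then show ?thesis
      using d_pos by eventually_elim simp
  qed
  \<comment> \<open>Domination by \<open>exp (- f x)\<close> bounds the conditional negative part by
    \<open>partition_fun x\<close>. Being finite, it can be subtracted in the balance.\<close>
  have "AE x in M. nn_cond_exp M F ?b x \<le> nn_cond_exp M F (\<lambda>x. ennreal (exp (- f x))) x"
  proof (rule nn_cond_exp_mono)
    show "AE x in M. ?b x \<le> ennreal (exp (- f x))"
      using d_pos
      by eventually_elim
        (use energy_negative_part_le in \<open>simp add: ennreal_mult'[symmetric] ennreal_leI\<close>)
  qed auto
  then have "AE x in M. nn_cond_exp M F ?b x < \<infinity>"
    using nn_cond_exp_eq_real_cond_exp[OF int exp_ge_zero]
  proof eventually_elim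
    case (elim x)
    then have "nn_cond_exp M F ?b x \<le> ennreal (partition_fun x)" by simp
    then show ?case
      by (rule order.strict_trans1) simp
  qed
  moreover have "AE x in M. nn_cond_exp M F (\<lambda>x. ennreal (d x) * ennreal (f x + ln (d x))) x
      = nn_cond_exp ?N F (\<lambda>x. ennreal (f x + ln (d x))) x"
    and "AE x in M. nn_cond_exp M F ?b x = nn_cond_exp ?N F (\<lambda>x. ennreal (- (f x + ln (d x)))) x"
    by (rule bayes; measurable)+
  ultimately show ?thesis
    using cond_energy_balance
    by eventually_elim (simp only: ereal_cond_exp_def ereal_diff_of_ennreal_balance)
qed

lemma ereal_cond_exp_energy_ge:
  "AE x in M. ereal (- ln (partition_fun x))
    \<le> ereal_cond_exp (density M (\<lambda>x. ennreal (d x))) F (\<lambda>x. f x + ln (d x)) x"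
  using ereal_cond_exp_energy
proof eventually_elim
  case (elim x)
  have "0 - ereal (ln (partition_fun x))
      \<le> enn2ereal (nn_cond_exp M F (\<lambda>x. ennreal (relative_entropy_density f d x)) x)
        - ereal (ln (partition_fun x))"
    by (intro ereal_minus_mono) auto
  then show ?case
    using elim by simp
qed

text \<open>Equality means that the conditional relative entropy vanishes, hence so does its
  nonnegative integrand.\<close>

lemma ereal_cond_exp_energy_eq_iff:
  "(AE x in M. ereal_cond_exp (density M (\<lambda>x. ennreal (d x))) F (\<lambda>x. f x + ln (d x)) x
      = ereal (- ln (partition_fun x)))
    \<longleftrightarrow> (AE x in M. d x = gibbs_density f x)"
proof -
  let ?r = "\<lambda>x. ennreal (relative_entropy_density f d x)"
  have *: "enn2ereal r - ereal z = ereal (- z) \<longleftrightarrow> r = 0" for r z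
    by (cases r) auto
  have "(AE x in M. ereal_cond_exp (density M (\<lambda>x. ennreal (d x))) F (\<lambda>x. f x + ln (d x)) x
      = ereal (- ln (partition_fun x))) \<longleftrightarrow> (AE x in M. nn_cond_exp M F ?r x = 0)"
    using ereal_cond_exp_energy by (rule eventually_subst[OF eventually_mono]) (simp only: *)
  also have "\<dots> \<longleftrightarrow> (AE x in M. ?r x = 0)"
    by (rule nn_cond_exp_eq_0_iff) auto
  also have "\<dots> \<longleftrightarrow> (AE x in M. d x = gibbs_density f x)"
    using relative_entropy_density_eq_0_iff relative_entropy_density_nonneg
    by (intro eventually_subst, eventually_elim) (auto simp: ennreal_eq_0_iff)
  finally show ?thesis .
qed

end

end

end

section \<open>Application to path space\<close>

text \<open>Where \<open>\<bar>f w\<bar> \<le> 1\<close> the function is at most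
  \<open>exp 1\<close>, which is integrable for a finite measure; elsewhere the factor
  \<open>\<bar>f w\<bar>\<close> exceeds 1 and the assumed integrable function dominates.\<close>

lemma integrable_exp_minus:
  assumes "finite_measure M" and [measurable]: "f \<in> borel_measurable M"
    and int: "integrable M (\<lambda>w. \<bar>f w\<bar> * (1 + exp (- f w)))"
  shows "integrable M (\<lambda>w. exp (- f w) :: real)"
proof (rule Bochner_Integration.integrable_bound)
  interpret finite_measure M by fact
  show "integrable M (\<lambda>w. exp 1 + \<bar>f w\<bar> * (1 + exp (- f w)))"
    using int by auto
  show "AE w in M. norm (exp (- f w)) \<le> norm (exp 1 + \<bar>f w\<bar> * (1 + exp (- f w)))"
  proof (intro AE_I2)
    fix w
    have "exp (- f w) \<le> exp 1 + \<bar>f w\<bar> * (1 + exp (- f w))"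
    proof (cases "\<bar>f w\<bar> \<le> 1")
      case True
      then have "exp (- f w) \<le> exp 1" by simp
      moreover have "0 \<le> \<bar>f w\<bar> * (1 + exp (- f w))"
        by (intro mult_nonneg_nonneg add_nonneg_nonneg) auto
      ultimately show ?thesis by linarith
    next
      case False
      have "exp (- f w) \<le> 1 * (1 + exp (- f w))" by simp
      also have "\<dots> \<le> \<bar>f w\<bar> * (1 + exp (- f w))"
        using False by (intro mult_right_mono add_nonneg_nonneg) auto
      also have "\<dots> \<le> exp 1 + \<bar>f w\<bar> * (1 + exp (- f w))" by simp
      finally show ?thesis .
    qed
    then show "norm (exp (- f w)) \<le> norm (exp 1 + \<bar>f w\<bar> * (1 + exp (- f w)))"
      by simp
  qed
qed simp

theorem theorem4:
  fixes \<nu> :: "(real \<Rightarrow> real ^ 'n) measure"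
    and \<tau> :: "(real \<Rightarrow> real ^ 'n) \<Rightarrow> ereal"
    and f :: "(real \<Rightarrow> real ^ 'n) \<Rightarrow> real"
  assumes "prob_space \<nu>" and "sets \<nu> = sets path_space"
    and "path_stopping_time \<nu> \<tau>"
    and "f \<in> borel_measurable \<nu>"
    and "integrable \<nu> (\<lambda>w. \<bar>f w\<bar> * (1 + exp (- f w)))"
  shows "is_ess_inf (completion \<nu>) (admissible_measures \<nu> \<tau>) (cond_free_energy \<nu> \<tau> f)
           (\<lambda>w. ereal (- ln (cond_partition \<nu> \<tau> f w))) \<and>
         gibbs_measure \<nu> \<tau> f \<in> admissible_measures \<nu> \<tau> \<and>
         (\<forall>\<theta>\<in>admissible_measures \<nu> \<tau>.
           (AE w in \<nu>. cond_free_energy \<nu> \<tau> f \<theta> w = ereal (- ln (cond_partition \<nu> \<tau> f w)))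
             \<longleftrightarrow> \<theta> = gibbs_measure \<nu> \<tau> f)"
proof -
  interpret \<nu>: prob_space \<nu> by fact
  define M where "M = completion \<nu>"
  define F where "F = stopped_algebra \<nu> \<tau>"
  have AE_M: "(AE w in M. P w) \<longleftrightarrow> (AE w in \<nu>. P w)" for P
    unfolding M_def by (rule AE_completion_iff)
  have meas: "u \<in> borel_measurable M" if "u \<in> borel_measurable \<nu>" for u :: "_ \<Rightarrow> 'b :: topological_space"
    using that by (simp add: M_def measurable_completion)
  have space_\<nu>: "space path_space = space \<nu>"
    using assms(2) by (rule sets_eq_imp_space_eq[symmetric])
  have M_1: "emeasure M (space M) = 1"
    using \<nu>.emeasure_space_1 by (simp add: M_def)
  interpret M: finite_measure M
    using M_1 by (intro finite_measureI) simp
  interpret M: finite_measure_subalgebra M F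
    by unfold_locales (simp add: M_def F_def subalgebra_stopped_algebra assms)
  have f: "f \<in> borel_measurable M"
    by (rule meas) fact
  have "integrable \<nu> (\<lambda>w. exp (- f w))"
    using \<nu>.finite_measure_axioms assms(4,5) by (rule integrable_exp_minus)
  then have int: "integrable M (\<lambda>w. exp (- f w))"
    using assms(4) by (simp add: M_def integrable_completion)
  have partition: "cond_partition \<nu> \<tau> f = M.partition_fun f"
    by (simp add: cond_partition_def M_def F_def fun_eq_iff)

  note [measurable] = M.gibbs_density_measurable[OF f int]
  let ?\<rho> = "M.gibbs_density f"
  \<comment> \<open>The Gibbs density is measurable only for the completion. A Borel version yields
    a density with respect to \<nu> itself, comparable with Radon-Nikodym derivatives.\<close>
  from completion_ex_borel_measurable_real[of ?\<rho> \<nu>, folded M_def,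
      OF M.gibbs_density_measurable[OF f int]]
  obtain \<rho> where \<rho>[measurable]: "\<rho> \<in> borel_measurable \<nu>" and \<rho>_eq: "AE w in \<nu>. ?\<rho> w = \<rho> w"
    by blast
  have gibbs: "gibbs_measure \<nu> \<tau> f = density \<nu> (\<lambda>w. ennreal (\<rho> w))"
  proof (rule measure_eqI)
    have sub: "subalgebra (density M (\<lambda>w. ennreal (?\<rho> w))) path_space"
      using assms(2) space_\<nu> by (auto simp: subalgebra_def M_def)
    have eq: "gibbs_measure \<nu> \<tau> f = restr_to_subalg (density M (\<lambda>w. ennreal (?\<rho> w))) path_space"
      by (simp add: gibbs_measure_def M.gibbs_density_def partition M_def[symmetric])
    show "sets (gibbs_measure \<nu> \<tau> f) = sets (density \<nu> (\<lambda>w. ennreal (\<rho> w)))"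
      using assms(2) by (simp add: eq sets_restr_to_subalg[OF sub])
    fix A assume "A \<in> sets (gibbs_measure \<nu> \<tau> f)"
    then have A: "A \<in> sets path_space" "A \<in> sets \<nu>"
      using assms(2) by (simp_all add: eq sets_restr_to_subalg[OF sub])
    then have "A \<in> sets M"
      by (simp add: M_def)
    have "emeasure (gibbs_measure \<nu> \<tau> f) A = (\<integral>\<^sup>+w\<in>A. ennreal (?\<rho> w) \<partial>M)"
      using A \<open>A \<in> sets M\<close> by (simp add: eq emeasure_restr_to_subalg[OF sub] emeasure_density)
    also have "\<dots> = (\<integral>\<^sup>+w\<in>A. ennreal (?\<rho> w) \<partial>\<nu>)"
      by (rule nn_integral_completion[of \<nu>, folded M_def])
    also have "\<dots> = (\<integral>\<^sup>+w\<in>A. ennreal (\<rho> w) \<partial>\<nu>)"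
      using \<rho>_eq by (intro nn_integral_cong_AE) auto
    also have "\<dots> = emeasure (density \<nu> (\<lambda>w. ennreal (\<rho> w))) A"
      using A by (simp add: emeasure_density)
    finally show "emeasure (gibbs_measure \<nu> \<tau> f) A = emeasure (density \<nu> (\<lambda>w. ennreal (\<rho> w))) A" .
  qed

  define D where "D = RN_deriv \<nu>"
  define d where "d \<theta> w = enn2real (D \<theta> w)" for \<theta> w
  have D[measurable]: "D \<theta> \<in> borel_measurable \<nu>" for \<theta>
    by (simp add: D_def)
  have [measurable]: "D \<theta> \<in> borel_measurable M" for \<theta>
    by (rule meas) simp
  have d[measurable]: "d \<theta> \<in> borel_measurable M" for \<theta>
    unfolding d_def by measurable
  have adm: "density \<nu> (D \<theta>) = \<theta>"
      "AE w in \<nu>. ennreal (d \<theta> w) = D \<theta> w"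
      "AE w in M. 0 < d \<theta> w"
      "completion \<theta> = density M (\<lambda>w. ennreal (d \<theta> w))"
      "AE w in M. nn_cond_exp M F (\<lambda>w. ennreal (d \<theta> w)) w = 1"
    if \<theta>: "\<theta> \<in> admissible_measures \<nu> \<tau>" for \<theta>
  proof -
    have sets: "sets \<theta> = sets \<nu>"
      and ac: "absolutely_continuous \<nu> \<theta>" "absolutely_continuous \<theta> \<nu>"
      and \<theta>_prob: "prob_space \<theta>" and one: "AE w in M. nn_cond_exp M F (D \<theta>) w = 1"
      using \<theta> assms(2) by (simp_all add: admissible_measures_def AE_M D_def M_def[symmetric] F_def)
    interpret \<theta>: prob_space \<theta> by fact
    show dens: "density \<nu> (D \<theta>) = \<theta>"
      unfolding D_def using ac(1) sets by (rule \<nu>.density_RN_deriv)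
    have "AE w in \<nu>. D \<theta> w \<noteq> \<infinity>"
      unfolding D_def using \<theta>.sigma_finite_measure_axioms ac(1) sets by (rule \<nu>.RN_deriv_finite)
    then show dD: "AE w in \<nu>. ennreal (d \<theta> w) = D \<theta> w"
      by eventually_elim (simp add: d_def less_top)
    \<comment> \<open>The density is nonzero almost everywhere for its own measure \<theta>, and
      absolute continuity of \<nu> with respect to \<theta> carries this over to \<nu>.\<close>
    have "AE w in density \<nu> (D \<theta>). D \<theta> w \<noteq> 0"
      by (auto simp: AE_density)
    then have nz: "AE w in \<nu>. D \<theta> w \<noteq> 0"
      unfolding dens by (rule absolutely_continuous_AE[OF sets[symmetric] ac(2)])
    show "AE w in M. 0 < d \<theta> w"
      unfolding AE_M using dD nz
      by eventually_elim (metis ennreal_0 enn2real_nonneg d_def order_le_less)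
    have "completion \<theta> = density M (D \<theta>)"
      using completion_density[OF D nz] by (simp add: dens M_def)
    also have "\<dots> = density M (\<lambda>w. ennreal (d \<theta> w))"
      using dD by (intro density_cong) (auto simp: AE_M)
    finally show "completion \<theta> = density M (\<lambda>w. ennreal (d \<theta> w))" .
    have "AE w in M. nn_cond_exp M F (\<lambda>w. ennreal (d \<theta> w)) w = nn_cond_exp M F (D \<theta>) w"
      using dD by (intro M.nn_cond_exp_cong) (auto simp: AE_M)
    with one show "AE w in M. nn_cond_exp M F (\<lambda>w. ennreal (d \<theta> w)) w = 1"
      by eventually_elim simp
  qed
  have energy: "cond_free_energy \<nu> \<tau> f \<theta>
      = ereal_cond_exp (density M (\<lambda>w. ennreal (d \<theta> w))) F (\<lambda>w. f w + ln (d \<theta> w))"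
    if "\<theta> \<in> admissible_measures \<nu> \<tau>" for \<theta>
    unfolding cond_free_energy_def adm(4)[OF that] by (simp add: F_def d_def D_def)

  have gibbs_adm: "gibbs_measure \<nu> \<tau> f \<in> admissible_measures \<nu> \<tau>"
  proof -
    let ?\<theta> = "density \<nu> (\<lambda>w. ennreal (\<rho> w))"
    have [measurable]: "\<rho> \<in> borel_measurable M"
      by (rule meas) fact
    have nz: "AE w in \<nu>. ennreal (\<rho> w) \<noteq> 0"
      using M.gibbs_density_pos[OF f int] \<rho>_eq unfolding AE_M
      by eventually_elim (simp add: ennreal_eq_0_iff)
    \<comment> \<open>Equality of the null sets gives both directions of absolute continuity at
      once.\<close>
    have null: "null_sets ?\<theta> = null_sets \<nu>"
      using nz by (intro null_sets_density_pos) auto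
    have "AE w in M. nn_cond_exp M F (\<lambda>w. ennreal (\<rho> w)) w
        = nn_cond_exp M F (\<lambda>w. ennreal (?\<rho> w)) w"
      using \<rho>_eq by (intro M.nn_cond_exp_cong) (auto simp: AE_M)
    then have one: "AE w in M. nn_cond_exp M F (\<lambda>w. ennreal (\<rho> w)) w = 1"
      using M.nn_cond_exp_gibbs_density[OF f int] by eventually_elim simp
    have "completion ?\<theta> = density M (\<lambda>w. ennreal (\<rho> w))"
      unfolding M_def using nz by (intro completion_density) auto
    \<comment> \<open>Integrating the conditional normalisation gives total mass 1.\<close>
    then have "emeasure (completion ?\<theta>) (space M) = 1"
      using M.emeasure_density_cond_exp_1[OF _ one] M_1 by simp
    then have "prob_space ?\<theta>"
      by (intro prob_spaceI) (simp add: M_def)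
    moreover have "AE w in M. nn_cond_exp M F (RN_deriv \<nu> ?\<theta>) w = 1"
    proof -
      have "AE w in M. ennreal (\<rho> w) = RN_deriv \<nu> ?\<theta> w"
        unfolding AE_M by (rule \<nu>.RN_deriv_unique) auto
      then have "AE w in M. nn_cond_exp M F (\<lambda>w. ennreal (\<rho> w)) w = nn_cond_exp M F (RN_deriv \<nu> ?\<theta>) w"
        by (intro M.nn_cond_exp_cong meas) auto
      with one show ?thesis
        by eventually_elim simp
    qed
    ultimately show ?thesis
      using null assms(2)
      by (simp add: gibbs admissible_measures_def absolutely_continuous_def AE_M M_def[symmetric]
          F_def[symmetric])
  qed

  have eq_iff: "(AE w in \<nu>. cond_free_energy \<nu> \<tau> f \<theta> w = ereal (- ln (cond_partition \<nu> \<tau> f w)))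
      \<longleftrightarrow> \<theta> = gibbs_measure \<nu> \<tau> f" if \<theta>: "\<theta> \<in> admissible_measures \<nu> \<tau>" for \<theta>
  proof -
    have "(AE w in \<nu>. cond_free_energy \<nu> \<tau> f \<theta> w = ereal (- ln (cond_partition \<nu> \<tau> f w)))
        \<longleftrightarrow> (AE w in \<nu>. d \<theta> w = ?\<rho> w)"
      using M.ereal_cond_exp_energy_eq_iff[OF f int d adm(3)[OF \<theta>] adm(5)[OF \<theta>]]
      unfolding energy[OF \<theta>] partition AE_M .
    also have "\<dots> \<longleftrightarrow> (AE w in \<nu>. D \<theta> w = ennreal (\<rho> w))"
      using adm(2)[OF \<theta>] \<rho>_eq M.gibbs_density_pos[OF f int, unfolded AE_M]
    proof (intro eventually_subst, eventually_elim)
      case (elim w)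
      \<comment> \<open>Equality in \<open>ennreal\<close> gives back equality of reals only for
        nonnegative values, hence this bound and the positivity of the Gibbs density.\<close>
      have "0 \<le> d \<theta> w" by (simp add: d_def)
      then show ?case
        using elim by (metis ennreal_inj less_imp_le)
    qed
    also have "\<dots> \<longleftrightarrow> density \<nu> (D \<theta>) = density \<nu> (\<lambda>w. ennreal (\<rho> w))"
      by (rule \<nu>.density_unique_iff[symmetric]) auto
    finally show ?thesis
      unfolding gibbs adm(1)[OF \<theta>] .
  qed

  have "is_ess_inf M (admissible_measures \<nu> \<tau>) (cond_free_energy \<nu> \<tau> f)
      (\<lambda>w. ereal (- ln (cond_partition \<nu> \<tau> f w)))"
    unfolding is_ess_inf_def
  proof (intro conjI ballI impI)
    show "(\<lambda>w. ereal (- ln (cond_partition \<nu> \<tau> f w))) \<in> borel_measurable M"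
      unfolding partition by measurable
    show "AE w in M. ereal (- ln (cond_partition \<nu> \<tau> f w)) \<le> cond_free_energy \<nu> \<tau> f \<theta> w"
      if \<theta>: "\<theta> \<in> admissible_measures \<nu> \<tau>" for \<theta>
      unfolding energy[OF \<theta>] partition
      by (rule M.ereal_cond_exp_energy_ge[OF f int d adm(3)[OF \<theta>] adm(5)[OF \<theta>]])
    \<comment> \<open>Attainment settles maximality: a common lower bound lies below the energy of
      the Gibbs measure, which is the claimed infimum.\<close>
    fix Y assume "\<forall>\<theta>\<in>admissible_measures \<nu> \<tau>. AE w in M. Y w \<le> cond_free_energy \<nu> \<tau> f \<theta> w"
    then have "AE w in \<nu>. Y w \<le> cond_free_energy \<nu> \<tau> f (gibbs_measure \<nu> \<tau> f) w"
      using gibbs_adm by (simp add: AE_M)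
    moreover have "AE w in \<nu>. cond_free_energy \<nu> \<tau> f (gibbs_measure \<nu> \<tau> f) w
        = ereal (- ln (cond_partition \<nu> \<tau> f w))"
      using eq_iff[OF gibbs_adm] by simp
    ultimately show "AE w in M. Y w \<le> ereal (- ln (cond_partition \<nu> \<tau> f w))"
      unfolding AE_M by eventually_elim simp
  qed
  then show ?thesis
    using gibbs_adm eq_iff by (simp add: M_def)
qed

end
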